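(* Let $M,N$ be positive integers and let $X_{ij},Y_i\in\mathbb{R}$ for $i=1,\ldots,M$, $j=1,\ldots,N$, be such that for each $j=1,\ldots,N$ there is at least one $i$ with $X_{ij}\neq 0$. Consider the problem $$\text{(A)}\qquad \min_{\theta_1,\ldots,\theta_N\in\mathbb{R}}\ \max_{1\le i\le M}\left|\sum_{j=1}^{N}X_{ij}\theta_j-Y_i\right|$$ and the problem $$\text{(B)}\qquad \min_{\theta_1,\ldots,\theta_{N-1}\in\mathbb{R}}\ \max_{\substack{1\le i<k\le M\\ |X_{iN}|+|X_{kN}|\ne 0}}\left|\sum_{j=1}^{N-1}\frac{X_{ij}X_{kN}-X_{kj}X_{iN}}{|X_{iN}|+|X_{kN}|}\,\theta_j-\frac{Y_iX_{kN}-Y_kX_{iN}}{|X_{iN}|+|X_{kN}|}\right|.$$ Let $\mu$ be the minimum of the objective function in (B). Then solving (A) is equivalent to solving (B) together with the double inequality $$\text{(C)}\qquad \max_{\substack{1\le i\le M\\ X_{iN}\ne 0}}\left(-\frac{\mu}{|X_{iN}|}-\sum_{j=1}^{N-1}\frac{X_{ij}}{X_{iN}}\theta_j+\frac{Y_i}{X_{iN}}\right)\le\theta_N\le\min_{\substack{1\le i\le M\\ X_{iN}\ne 0}}\left(\frac{\mu}{|X_{iN}|}-\sum_{j=1}^{N-1}\frac{X_{ij}}{X_{iN}}\theta_j+\frac{Y_i}{X_{iN}}\right).$$ That is, the minimum value of the objective function in (A) equals $\mu$, and a vector $(\theta_1,\ldots,\theta_N)\in\mathbb{R}^N$ is a minimizer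 of (A) if and only if $(\theta_1,\ldots,\theta_{N-1})$ is a minimizer of (B) and $\theta_N$ satisfies (C).
   Context: Empty sums are defined to be zero; in particular, for $N=1$ problem (B) has no unknowns and its objective is a constant, whose value is $\mu$ (every choice, i.e. the empty tuple, is a minimizer). The maximum in (B) over an empty set of index pairs (which occurs only for $M=1$) is taken to be $0$. *)

theory Defs
  imports "HOL-Analysis.Analysis"
begin

text \<open>
  A vector of length \<open>n\<close> is a function on the indices \<open>1, \<dots>, n\<close>, extended by \<open>undefined\<close>
  elsewhere so that it is determined by its components; \<open>tuples 0\<close> is a singleton.
  Indices of \<open>X\<close> and \<open>Y\<close> start at \<open>1\<close>; values outside the stated ranges are never used.
\<close>

definition tuples :: "nat \<Rightarrow> (nat \<Rightarrow> real) set" where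
  "tuples n = {1..n} \<rightarrow>\<^sub>E UNIV"

definition is_minimum :: "('a \<Rightarrow> real) \<Rightarrow> 'a set \<Rightarrow> real \<Rightarrow> bool" where
  "is_minimum f S m \<longleftrightarrow> m \<in> f ` S \<and> (\<forall>x\<in>S. m \<le> f x)"

definition is_minimizer :: "('a \<Rightarrow> real) \<Rightarrow> 'a set \<Rightarrow> 'a \<Rightarrow> bool" where
  "is_minimizer f S = is_arg_min f (\<lambda>x. x \<in> S)"

definition objective_A ::
  "nat \<Rightarrow> nat \<Rightarrow> (nat \<Rightarrow> nat \<Rightarrow> real) \<Rightarrow> (nat \<Rightarrow> real) \<Rightarrow> (nat \<Rightarrow> real) \<Rightarrow> real" where
  "objective_A M N X Y \<theta> = (MAX i\<in>{1..M}. \<bar>(\<Sum>j=1..N. X i j * \<theta> j) - Y i\<bar>)"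

definition pairs_B :: "nat \<Rightarrow> nat \<Rightarrow> (nat \<Rightarrow> nat \<Rightarrow> real) \<Rightarrow> (nat \<times> nat) set" where
  "pairs_B M N X = {(i, k). 1 \<le> i \<and> i < k \<and> k \<le> M \<and> \<bar>X i N\<bar> + \<bar>X k N\<bar> \<noteq> 0}"

text \<open>\<open>Max {}\<close> is unspecified, so the value \<open>0\<close> of an empty maximum is made explicit.\<close>

definition objective_B ::
  "nat \<Rightarrow> nat \<Rightarrow> (nat \<Rightarrow> nat \<Rightarrow> real) \<Rightarrow> (nat \<Rightarrow> real) \<Rightarrow> (nat \<Rightarrow> real) \<Rightarrow> real" where
  "objective_B M N X Y \<theta> =
    (if pairs_B M N X = {} then 0
     else MAX (i, k)\<in>pairs_B M N X.
       \<bar>(\<Sum>j=1..N-1. (X i j * X k N - X k j * X i N) / (\<bar>X i N\<bar> + \<bar>X k N\<bar>) * \<theta> j)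
         - (Y i * X k N - Y k * X i N) / (\<bar>X i N\<bar> + \<bar>X k N\<bar>)\<bar>)"

definition condition_C ::
  "nat \<Rightarrow> nat \<Rightarrow> (nat \<Rightarrow> nat \<Rightarrow> real) \<Rightarrow> (nat \<Rightarrow> real) \<Rightarrow> real \<Rightarrow> (nat \<Rightarrow> real) \<Rightarrow> bool" where
  "condition_C M N X Y \<mu> \<theta> \<longleftrightarrow>
    (MAX i\<in>{i\<in>{1..M}. X i N \<noteq> 0}.
       - (\<mu> / \<bar>X i N\<bar>) - (\<Sum>j=1..N-1. X i j / X i N * \<theta> j) + Y i / X i N) \<le> \<theta> N \<and>
    \<theta> N \<le> (MIN i\<in>{i\<in>{1..M}. X i N \<noteq> 0}.
       \<mu> / \<bar>X i N\<bar> - (\<Sum>j=1..N-1. X i j / X i N * \<theta> j) + Y i / X i N)"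

end

theory Submission
  imports Defs
begin

text \<open>
  The residuals in (A) are \<open>r\<^sub>i + a\<^sub>i t\<close> with \<open>t = \<theta>\<^sub>N\<close>, \<open>a\<^sub>i = X\<^sub>i\<^sub>N\<close> and \<open>r\<^sub>i\<close> depending only
  on the other unknowns. For \<open>a\<^sub>i \<noteq> 0\<close> the inequality \<open>\<bar>r\<^sub>i + a\<^sub>i t\<bar> \<le> m\<close> confines \<open>t\<close> to a compact interval,
  and finitely many intervals have a common point as soon as they meet pairwise, which is the
  inequality \<open>\<bar>r\<^sub>i a\<^sub>k - r\<^sub>k a\<^sub>i\<bar> \<le> m (\<bar>a\<^sub>i\<bar> + \<bar>a\<^sub>k\<bar>)\<close> of (B). So the objective of (B) is the minimum over \<open>t\<close>
  of the objective of (A), and (C) at level \<open>\<mu>\<close> describes the common points of the intervals.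
  As (B) is a problem of the same kind as (A) with one unknown fewer, repeating the
  elimination also shows that the minimum of (A) is attained.
\<close>

section \<open>Bounds on finitely many affine functions of one variable\<close>

lemma abs_affine_le_iff:
  fixes a r t m :: real
  assumes "a \<noteq> 0"
  shows "\<bar>r + a * t\<bar> \<le> m \<longleftrightarrow> - (m / \<bar>a\<bar>) - r / a \<le> t \<and> t \<le> m / \<bar>a\<bar> - r / a"
proof -
  have "r + a * t = a * (t + r / a)"
    using assms by (simp add: field_simps)
  then have "\<bar>r + a * t\<bar> \<le> m \<longleftrightarrow> \<bar>t + r / a\<bar> \<le> m / \<bar>a\<bar>"
    using assms by (simp add: abs_mult pos_le_divide_eq mult.commute)
  then show ?thesis
    by (auto simp: abs_le_iff)
qed

text \<open>Multiplying by \<open>a k\<close> and \<open>a i\<close> and subtracting cancels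
  \<open>t\<close>, which gives one direction. For the other, the largest left endpoint serves as
  \<open>t\<close>. Some \<open>a i\<close> must be nonzero: otherwise the right side is vacuous
  while the left still bounds every \<open>r i\<close>.\<close>

lemma ex_abs_affine_le_iff:
  fixes a r :: "'i \<Rightarrow> real"
  assumes "finite I" and nz: "\<exists>i\<in>I. a i \<noteq> 0"
  shows "(\<exists>t. \<forall>i\<in>I. \<bar>r i + a i * t\<bar> \<le> m) \<longleftrightarrow>
    (\<forall>i\<in>I. \<forall>k\<in>I. \<bar>a i\<bar> + \<bar>a k\<bar> \<noteq> 0 \<longrightarrow> \<bar>r i * a k - r k * a i\<bar> \<le> m * (\<bar>a i\<bar> + \<bar>a k\<bar>))"
    (is "_ \<longleftrightarrow> ?R")
proof
  assume "\<exists>t. \<forall>i\<in>I. \<bar>r i + a i * t\<bar> \<le> m"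
  then obtain t where t: "\<And>i. i \<in> I \<Longrightarrow> \<bar>r i + a i * t\<bar> \<le> m"
    by blast
  have "\<bar>r i * a k - r k * a i\<bar> \<le> m * (\<bar>a i\<bar> + \<bar>a k\<bar>)" if "i \<in> I" "k \<in> I" for i k
  proof -
    have "r i * a k - r k * a i = (r i + a i * t) * a k - (r k + a k * t) * a i"
      by (simp add: algebra_simps)
    also have "\<bar>\<dots>\<bar> \<le> \<bar>r i + a i * t\<bar> * \<bar>a k\<bar> + \<bar>r k + a k * t\<bar> * \<bar>a i\<bar>"
      by (metis abs_mult abs_triangle_ineq4)
    also have "\<dots> \<le> m * \<bar>a k\<bar> + m * \<bar>a i\<bar>"
      using t that by (intro add_mono mult_right_mono) auto
    finally show ?thesis
      by (simp add: algebra_simps)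
  qed
  then show ?R by blast
next
  assume R: ?R
  define J where "J = {i \<in> I. a i \<noteq> 0}"
  define l where "l i = - (m / \<bar>a i\<bar>) - r i / a i" for i
  have J: "finite J" "J \<noteq> {}"
    using assms by (auto simp: J_def)
  have meet: "l i \<le> m / \<bar>a k\<bar> - r k / a k" if "i \<in> J" "k \<in> J" for i k
  proof -
    have nz: "a i \<noteq> 0" "a k \<noteq> 0"
      using that by (auto simp: J_def)
    have "r k / a k - r i / a i = (r k * a i - r i * a k) / (a i * a k)"
      using nz by (simp add: field_simps)
    also have "\<dots> \<le> \<bar>r i * a k - r k * a i\<bar> / \<bar>a i * a k\<bar>"
      by (metis abs_divide abs_ge_self abs_minus_commute)
    also have "\<dots> \<le> m * (\<bar>a i\<bar> + \<bar>a k\<bar>) / \<bar>a i * a k\<bar>"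
      using R that nz by (intro divide_right_mono) (auto simp: J_def)
    also have "\<dots> = m / \<bar>a i\<bar> + m / \<bar>a k\<bar>"
      using nz by (simp add: abs_mult field_simps)
    finally show ?thesis
      by (simp add: l_def)
  qed
  have "\<bar>r i + a i * Max (l ` J)\<bar> \<le> m" if i: "i \<in> I" for i
  proof (cases "a i = 0")
    case True
    \<comment> \<open>A row not involving \<open>t\<close> is controlled by pairing it with one that
      does: the pair inequality is the wanted bound multiplied by
      \<open>\<bar>a k\<bar>\<close>.\<close>
    obtain k where "k \<in> I" "a k \<noteq> 0"
      using nz by blast
    with R i have "\<bar>r i * a k - r k * a i\<bar> \<le> m * (\<bar>a i\<bar> + \<bar>a k\<bar>)"
      by simp
    with True \<open>a k \<noteq> 0\<close> show ?thesis
      by (simp add: abs_mult)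
  next
    case False
    with i have "i \<in> J"
      by (simp add: J_def)
    then have "l i \<le> Max (l ` J)" "Max (l ` J) \<le> m / \<bar>a i\<bar> - r i / a i"
      using J meet by auto
    with False show ?thesis
      by (simp add: abs_affine_le_iff l_def)
  qed
  then show "\<exists>t. \<forall>i\<in>I. \<bar>r i + a i * t\<bar> \<le> m"
    by blast
qed

section \<open>Residuals and elimination of one unknown\<close>

definition residual :: "nat \<Rightarrow> (nat \<Rightarrow> real) \<Rightarrow> real \<Rightarrow> (nat \<Rightarrow> real) \<Rightarrow> real" where
  "residual n c y \<theta> = (\<Sum>j=1..n. c j * \<theta> j) - y"

lemma residual_Suc: "residual (Suc n) c y \<theta> = residual n c y \<theta> + c (Suc n) * \<theta> (Suc n)"
  by (simp add: residual_def)

lemma residual_cong: "(\<And>j. j \<in> {1..n} \<Longrightarrow> \<theta> j = \<theta>' j) \<Longrightarrow> residual n c y \<theta> = residual n c y \<theta>'"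
  unfolding residual_def by (metis (no_types, lifting) sum.cong)

text \<open>The residual is linear in \<open>(c, y)\<close>, so it commutes with combining two rows.
  With \<open>a\<close>, \<open>b\<close> the last coefficients of the rows and
  \<open>d = \<bar>a\<bar> + \<bar>b\<bar>\<close>, this is the expression inside the absolute value
  in (B).\<close>

lemma residual_eliminate:
  "residual n (\<lambda>j. (c j * b - c' j * a) / d) ((y * b - y' * a) / d) \<theta> =
    (residual n c y \<theta> * b - residual n c' y' \<theta> * a) / d"
proof -
  have "(\<Sum>j=1..n. (c j * b - c' j * a) / d * \<theta> j) =
      ((\<Sum>j=1..n. c j * \<theta> j) * b - (\<Sum>j=1..n. c' j * \<theta> j) * a) / d"
    by (simp add: sum_distrib_right sum_divide_distrib flip: sum_subtractf)
      (simp add: algebra_simps diff_divide_distrib)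
  then show ?thesis
    by (simp add: residual_def algebra_simps diff_divide_distrib add_divide_distrib)
qed

lemma abs_residual_eliminate_le_iff:
  assumes "\<bar>a\<bar> + \<bar>b\<bar> \<noteq> 0"
  shows "\<bar>residual n (\<lambda>j. (c j * b - c' j * a) / (\<bar>a\<bar> + \<bar>b\<bar>)) ((y * b - y' * a) / (\<bar>a\<bar> + \<bar>b\<bar>)) \<theta>\<bar> \<le> m \<longleftrightarrow>
    \<bar>residual n c y \<theta> * b - residual n c' y' \<theta> * a\<bar> \<le> m * (\<bar>a\<bar> + \<bar>b\<bar>)"
proof -
  have "0 < \<bar>a\<bar> + \<bar>b\<bar>"
    using assms by linarith
  then show ?thesis
    by (simp add: residual_eliminate abs_divide pos_divide_le_eq)
qed

section \<open>Attainment of the minimum, by induction on the number of unknowns\<close>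

text \<open>A problem is encoded as the set of its rows \<open>(c, y)\<close>, so that the induction
  does not change the type of the row indices.\<close>

lemma minimax_residual_attained:
  fixes F :: "((nat \<Rightarrow> real) \<times> real) set"
  assumes "finite F" and "F \<noteq> {}"
  shows "\<exists>m \<theta>. (\<forall>(c, y)\<in>F. \<bar>residual n c y \<theta>\<bar> \<le> m) \<and>
    (\<forall>m' \<theta>'. (\<forall>(c, y)\<in>F. \<bar>residual n c y \<theta>'\<bar> \<le> m') \<longrightarrow> m \<le> m')"
  using assms
proof (induction n arbitrary: F)
  case 0
  \<comment> \<open>Without unknowns the residual is \<open>- y\<close>, so every
    \<open>\<theta>\<close> is optimal.\<close>
  let ?m = "Max ((\<lambda>(c, y). \<bar>y\<bar>) ` F)"
  have "\<forall>(c, y)\<in>F. \<bar>residual 0 c y \<theta>\<bar> \<le> ?m" for \<theta>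
    using 0 by (auto simp: residual_def intro!: Max_ge image_eqI)
  moreover have "?m \<le> m'" if "\<forall>(c, y)\<in>F. \<bar>residual 0 c y \<theta>'\<bar> \<le> m'" for m' \<theta>'
    using that 0 by (auto simp: residual_def)
  ultimately show ?case by blast
next
  case (Suc n)
  show ?case
  proof (cases "\<forall>(c, y)\<in>F. c (Suc n) = 0")
    \<comment> \<open>Elimination would leave no rows here, but the last unknown does not occur and
      the induction hypothesis applies to \<open>F\<close> itself.\<close>
    case True
    then have "(\<forall>(c, y)\<in>F. \<bar>residual (Suc n) c y \<theta>\<bar> \<le> m) \<longleftrightarrow>
        (\<forall>(c, y)\<in>F. \<bar>residual n c y \<theta>\<bar> \<le> m)" for \<theta> m
      by (fastforce simp: residual_Suc)
    then show ?thesis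
      using Suc by simp
  next
    case False
    define a where "a p = fst p (Suc n)" for p :: "(nat \<Rightarrow> real) \<times> real"
    define r where "r \<theta> p = residual n (fst p) (snd p) \<theta>" for \<theta> and p :: "(nat \<Rightarrow> real) \<times> real"
    \<comment> \<open>All ordered pairs are taken, the diagonal included: a pair
      \<open>(p, p)\<close> with \<open>a p \<noteq> 0\<close> keeps the family nonempty even when
      \<open>F\<close> has a single row.\<close>
    define P where "P = {(p, q) \<in> F \<times> F. \<bar>a p\<bar> + \<bar>a q\<bar> \<noteq> 0}"
    define row where "row p q = (\<lambda>j. (fst p j * a q - fst q j * a p) / (\<bar>a p\<bar> + \<bar>a q\<bar>))" for p q
    define rhs where "rhs p q = (snd p * a q - snd q * a p) / (\<bar>a p\<bar> + \<bar>a q\<bar>)" for p q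
    define G where "G = (\<lambda>(p, q). (row p q, rhs p q)) ` P"
    have nz: "\<exists>p\<in>F. a p \<noteq> 0"
      using False by (fastforce simp: a_def)
    then obtain p where "p \<in> F" "a p \<noteq> 0"
      by blast
    then have "(p, p) \<in> P"
      by (simp add: P_def)
    moreover have "finite P"
      using Suc.prems by (intro finite_subset[of P "F \<times> F"]) (auto simp: P_def)
    ultimately have P: "finite P" "P \<noteq> {}"
      by auto
    have "\<bar>residual n (row p q) (rhs p q) \<theta>\<bar> \<le> m \<longleftrightarrow>
        \<bar>r \<theta> p * a q - r \<theta> q * a p\<bar> \<le> m * (\<bar>a p\<bar> + \<bar>a q\<bar>)"
      if "\<bar>a p\<bar> + \<bar>a q\<bar> \<noteq> 0" for p q \<theta> m
      unfolding row_def rhs_def r_def by (rule abs_residual_eliminate_le_iff[OF that])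
    then have G: "(\<forall>(c, y)\<in>G. \<bar>residual n c y \<theta>\<bar> \<le> m) \<longleftrightarrow> (\<exists>t. \<forall>p\<in>F. \<bar>r \<theta> p + a p * t\<bar> \<le> m)" for \<theta> m
      unfolding ex_abs_affine_le_iff[OF Suc.prems(1) nz] G_def P_def by fast
    have F: "(\<forall>(c, y)\<in>F. \<bar>residual (Suc n) c y \<theta>\<bar> \<le> m) \<longleftrightarrow>
        (\<forall>p\<in>F. \<bar>r \<theta> p + a p * \<theta> (Suc n)\<bar> \<le> m)" for \<theta> m
      by (auto simp: residual_Suc r_def a_def)
    obtain m \<theta> where m: "\<forall>(c, y)\<in>G. \<bar>residual n c y \<theta>\<bar> \<le> m"
      and min: "\<And>m' \<theta>'. \<forall>(c, y)\<in>G. \<bar>residual n c y \<theta>'\<bar> \<le> m' \<Longrightarrow> m \<le> m'"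
    proof -
      have "finite G" "G \<noteq> {}"
        using P by (auto simp: G_def)
      from Suc.IH[OF this] show ?thesis
        using that by blast
    qed
    \<comment> \<open>An optimum of \<open>G\<close> extends by this value of the last unknown to a
      point where \<open>F\<close> reaches the same level.\<close>
    obtain t where t: "\<forall>p\<in>F. \<bar>r \<theta> p + a p * t\<bar> \<le> m"
      using m G by blast
    have "r (\<theta>(Suc n := t)) p = r \<theta> p" for p
      unfolding r_def by (rule residual_cong) auto
    with t have "\<forall>(c, y)\<in>F. \<bar>residual (Suc n) c y (\<theta>(Suc n := t))\<bar> \<le> m"
      by (simp add: F)
    \<comment> \<open>Any \<open>\<theta>'\<close> is also a candidate for \<open>G\<close>, with
      its own component \<open>Suc n\<close> as the witness \<open>t\<close>.\<close>
    moreover have "m \<le> m'" if "\<forall>(c, y)\<in>F. \<bar>residual (Suc n) c y \<theta>'\<bar> \<le> m'" for m' \<theta>'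
      using that min G F by blast
    ultimately show ?thesis by blast
  qed
qed

section \<open>Sublevel sets of the two objectives\<close>

lemma objective_A_le_iff:
  assumes "M \<ge> 1"
  shows "objective_A M N X Y \<theta> \<le> m \<longleftrightarrow> (\<forall>i\<in>{1..M}. \<bar>residual N (X i) (Y i) \<theta>\<bar> \<le> m)"
  using assms by (simp add: objective_A_def residual_def)

lemma objective_A_Suc_le_iff:
  assumes "M \<ge> 1"
  shows "objective_A M (Suc n) X Y \<theta> \<le> m \<longleftrightarrow>
    (\<forall>i\<in>{1..M}. \<bar>residual n (X i) (Y i) \<theta> + X i (Suc n) * \<theta> (Suc n)\<bar> \<le> m)"
  using assms by (simp only: objective_A_le_iff residual_Suc)

lemma finite_pairs_B: "finite (pairs_B M N X)"
  by (rule finite_subset[of _ "{1..M} \<times> {1..M}"]) (auto simp: pairs_B_def)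

text \<open>The bound \<open>0 \<le> m\<close> settles the case of no pairs: the objective is then
  \<open>0\<close> by convention and the right side is vacuous.\<close>

lemma objective_B_le_iff_pairs:
  assumes "0 \<le> m"
  shows "objective_B M (Suc n) X Y \<theta> \<le> m \<longleftrightarrow>
    (\<forall>(i, k)\<in>pairs_B M (Suc n) X.
      \<bar>residual n (X i) (Y i) \<theta> * X k (Suc n) - residual n (X k) (Y k) \<theta> * X i (Suc n)\<bar>
        \<le> m * (\<bar>X i (Suc n)\<bar> + \<bar>X k (Suc n)\<bar>))"
proof (cases "pairs_B M (Suc n) X = {}")
  case True
  then show ?thesis
    using assms by (simp add: objective_B_def)
next
  case False
  let ?d = "\<lambda>i k. \<bar>X i (Suc n)\<bar> + \<bar>X k (Suc n)\<bar>"
  let ?q = "\<lambda>(i, k). \<bar>residual n (\<lambda>j. (X i j * X k (Suc n) - X k j * X i (Suc n)) / ?d i k)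
      ((Y i * X k (Suc n) - Y k * X i (Suc n)) / ?d i k) \<theta>\<bar>"
  have "objective_B M (Suc n) X Y \<theta> = Max (?q ` pairs_B M (Suc n) X)"
    using False by (simp add: objective_B_def residual_def)
  then have "objective_B M (Suc n) X Y \<theta> \<le> m \<longleftrightarrow> (\<forall>p\<in>pairs_B M (Suc n) X. ?q p \<le> m)"
    using False finite_pairs_B by simp
  also have "\<dots> \<longleftrightarrow> (\<forall>(i, k)\<in>pairs_B M (Suc n) X.
      \<bar>residual n (X i) (Y i) \<theta> * X k (Suc n) - residual n (X k) (Y k) \<theta> * X i (Suc n)\<bar>
        \<le> m * ?d i k)"
  proof (rule ball_cong[OF refl])
    fix p
    assume "p \<in> pairs_B M (Suc n) X"
    then obtain i k where p: "p = (i, k)" and d: "?d i k \<noteq> 0"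
      by (auto simp: pairs_B_def)
    show "?q p \<le> m \<longleftrightarrow> (case p of (i, k) \<Rightarrow>
      \<bar>residual n (X i) (Y i) \<theta> * X k (Suc n) - residual n (X k) (Y k) \<theta> * X i (Suc n)\<bar>
        \<le> m * ?d i k)"
      unfolding p prod.case by (rule abs_residual_eliminate_le_iff[OF d])
  qed
  finally show ?thesis .
qed

lemma objective_B_nonneg: "0 \<le> objective_B M N X Y \<theta>"
proof (cases "pairs_B M N X = {}")
  case False
  then obtain i k where "(i, k) \<in> pairs_B M N X"
    by auto
  then show ?thesis
    using False finite_pairs_B
    by (auto simp: objective_B_def Max_ge_iff intro!: bexI[of _ "(i, k)"])
qed (simp add: objective_B_def)

text \<open>(B) ranges over \<open>i < k\<close>, the one-variable criterion over all ordered pairs.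
  The inequality is symmetric in the pair and, for \<open>0 \<le> m\<close>, trivial on the
  diagonal. For negative \<open>m\<close> both sides fail.\<close>

lemma objective_B_le_iff:
  assumes nz: "\<exists>i\<in>{1..M}. X i (Suc n) \<noteq> 0"
  shows "objective_B M (Suc n) X Y \<theta> \<le> m \<longleftrightarrow>
    (\<exists>t. \<forall>i\<in>{1..M}. \<bar>residual n (X i) (Y i) \<theta> + X i (Suc n) * t\<bar> \<le> m)"
proof (cases "0 \<le> m")
  case True
  define r where "r i = residual n (X i) (Y i) \<theta>" for i
  define a where "a i = X i (Suc n)" for i
  define Q where "Q i k \<longleftrightarrow> \<bar>a i\<bar> + \<bar>a k\<bar> \<noteq> 0 \<longrightarrow>
    \<bar>r i * a k - r k * a i\<bar> \<le> m * (\<bar>a i\<bar> + \<bar>a k\<bar>)" for i k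
  have "Q i i" for i
    using True by (simp add: Q_def)
  moreover have "Q i k \<longleftrightarrow> Q k i" for i k
    by (simp add: Q_def add.commute abs_minus_commute)
  ultimately have "(\<forall>i\<in>{1..M}. \<forall>k\<in>{1..M}. Q i k) \<longleftrightarrow> (\<forall>i\<in>{1..M}. \<forall>k\<in>{1..M}. i < k \<longrightarrow> Q i k)"
    by (metis linorder_neqE_nat)
  also have "\<dots> \<longleftrightarrow> objective_B M (Suc n) X Y \<theta> \<le> m"
    unfolding objective_B_le_iff_pairs[OF True]
    by (force simp: pairs_B_def Q_def a_def r_def)
  finally show ?thesis
    using ex_abs_affine_le_iff[of "{1..M}" a r m] nz by (simp add: Q_def a_def r_def)
next
  case False
  then show ?thesis
    using objective_B_nonneg[of M "Suc n" X Y \<theta>] nz by fastforce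
qed

lemma objective_B_restrict:
  "objective_B M N X Y (restrict \<theta> {1..N-1}) = objective_B M N X Y \<theta>"
proof -
  have "(\<Sum>j=1..N-1. c j * restrict \<theta> {1..N-1} j) = (\<Sum>j=1..N-1. c j * \<theta> j)" for c :: "nat \<Rightarrow> real"
    by (rule sum.cong) auto
  then show ?thesis
    by (simp only: objective_B_def)
qed

section \<open>Condition (C) and the link between (A) and (B)\<close>

lemma condition_C_iff:
  assumes nz: "\<exists>i\<in>{1..M}. X i (Suc n) \<noteq> 0"
  shows "condition_C M (Suc n) X Y \<mu> \<theta> \<longleftrightarrow> (\<forall>i\<in>{1..M}. X i (Suc n) \<noteq> 0 \<longrightarrow>
    \<bar>residual n (X i) (Y i) \<theta> + X i (Suc n) * \<theta> (Suc n)\<bar> \<le> \<mu>)"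
proof -
  have ne: "{i \<in> {1..M}. X i (Suc n) \<noteq> 0} \<noteq> {}"
    using nz by blast
  have "(\<Sum>j=1..n. X i j / X i (Suc n) * \<theta> j) =
      residual n (X i) (Y i) \<theta> / X i (Suc n) + Y i / X i (Suc n)" for i
    by (simp add: residual_def sum_divide_distrib diff_divide_distrib)
  then show ?thesis
    using ne by (auto simp: condition_C_def abs_affine_le_iff)
qed

text \<open>(C) leaves out the rows with \<open>X i (Suc n) = 0\<close>, but their residuals do not
  depend on the last unknown, so the \<open>t\<close> provided by (B) bounds them. Conversely,
  \<open>\<theta> (Suc n)\<close> serves as this \<open>t\<close>.\<close>

lemma objective_A_le_iff_B_C:
  assumes "M \<ge> 1" and nz: "\<exists>i\<in>{1..M}. X i (Suc n) \<noteq> 0"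
  shows "objective_A M (Suc n) X Y \<theta> \<le> m \<longleftrightarrow>
    objective_B M (Suc n) X Y \<theta> \<le> m \<and> condition_C M (Suc n) X Y m \<theta>"
  unfolding objective_A_Suc_le_iff[OF assms(1)] condition_C_iff[where X = X, OF nz]
    objective_B_le_iff[where X = X, OF nz]
  by (metis add.right_neutral mult_zero_left)

lemma objective_B_le_iff_A:
  assumes "M \<ge> 1" and nz: "\<exists>i\<in>{1..M}. X i (Suc n) \<noteq> 0"
  shows "objective_B M (Suc n) X Y \<theta> \<le> m \<longleftrightarrow>
    (\<exists>t. objective_A M (Suc n) X Y (\<theta>(Suc n := t)) \<le> m)"
proof -
  have "residual n c y (\<theta>(Suc n := t)) = residual n c y \<theta>" for c y t
    by (rule residual_cong) auto
  then show ?thesis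
    by (simp add: objective_A_Suc_le_iff[OF assms(1)] objective_B_le_iff[where X = X, OF nz])
qed

theorem lemma1:
  fixes M N :: nat and X :: "nat \<Rightarrow> nat \<Rightarrow> real" and Y :: "nat \<Rightarrow> real"
  assumes "M \<ge> 1" and "N \<ge> 1"
    and "\<forall>j\<in>{1..N}. \<exists>i\<in>{1..M}. X i j \<noteq> 0"
  shows "(\<exists>\<mu>. is_minimum (objective_B M N X Y) (tuples (N - 1)) \<mu>) \<and>
    (\<forall>\<mu>. is_minimum (objective_B M N X Y) (tuples (N - 1)) \<mu> \<longrightarrow>
      is_minimum (objective_A M N X Y) (tuples N) \<mu> \<and>
      (\<forall>\<theta>\<in>tuples N.
        is_minimizer (objective_A M N X Y) (tuples N) \<theta> \<longleftrightarrow>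
        is_minimizer (objective_B M N X Y) (tuples (N - 1)) (restrict \<theta> {1..N-1}) \<and>
        condition_C M N X Y \<mu> \<theta>))"
proof -
  obtain n where N: "N = Suc n"
    using assms(2) by (cases N) auto
  have nz: "\<exists>i\<in>{1..M}. X i (Suc n) \<noteq> 0"
    using assms(3) N by auto
  let ?A = "objective_A M N X Y" and ?B = "objective_B M N X Y"
  note A_iff = objective_A_le_iff_B_C[where X = X and Y = Y, OF assms(1) nz, folded N]
  note B_iff = objective_B_le_iff_A[where X = X and Y = Y, OF assms(1) nz, folded N]
  have restr: "restrict \<theta> {1..N-1} \<in> tuples (N - 1)" for \<theta>
    by (simp add: tuples_def)
  have upd: "\<theta>(N := t) \<in> tuples N" if "\<theta> \<in> tuples (N - 1)" for \<theta> t
    using that unfolding tuples_def N by (auto simp: PiE_iff extensional_def)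
  \<comment> \<open>The level is the value of (A) itself; the (B) half of the equivalence then gives
    the bound.\<close>
  have BA: "?B (restrict \<theta> {1..N-1}) \<le> ?A \<theta>" for \<theta>
    using A_iff[of \<theta> "?A \<theta>"] objective_B_restrict[of M N X Y \<theta>] by simp
  have "\<exists>\<mu>. is_minimum ?B (tuples (N - 1)) \<mu>"
  proof -
    have ne: "(\<lambda>i. (X i, Y i)) ` {1..M} \<noteq> {}"
      using assms(1) by simp
    \<comment> \<open>Here \<open>\<theta>\<close> is an arbitrary function; its restriction becomes
      the minimizer of (B).\<close>
    obtain m \<theta> where m: "?A \<theta> \<le> m" and min: "\<And>m' \<theta>'. ?A \<theta>' \<le> m' \<Longrightarrow> m \<le> m'"
      using minimax_residual_attained[OF _ ne, of N]
      unfolding ball_simps prod.case objective_A_le_iff[OF assms(1)] by blast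
    \<comment> \<open>Some extension of \<open>\<eta>\<close> reaches the level
      \<open>?B \<eta>\<close> in (A), so the optimality of \<open>m\<close> applies.\<close>
    have le: "m \<le> ?B \<eta>" for \<eta>
      using B_iff[of \<eta> "?B \<eta>"] min by auto
    have "?B (restrict \<theta> {1..N-1}) = m"
      using BA[of \<theta>] m le[of "restrict \<theta> {1..N-1}"] by linarith
    with le restr show ?thesis
      unfolding is_minimum_def by blast
  qed
  moreover have "is_minimum ?A (tuples N) \<mu> \<and>
      (\<forall>\<theta>\<in>tuples N. is_minimizer ?A (tuples N) \<theta> \<longleftrightarrow>
        is_minimizer ?B (tuples (N - 1)) (restrict \<theta> {1..N-1}) \<and> condition_C M N X Y \<mu> \<theta>)"
    if \<mu>: "is_minimum ?B (tuples (N - 1)) \<mu>" for \<mu>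
  proof -
    obtain \<eta> where \<eta>: "\<eta> \<in> tuples (N - 1)" "?B \<eta> = \<mu>"
      and \<mu>_le: "\<And>\<eta>. \<eta> \<in> tuples (N - 1) \<Longrightarrow> \<mu> \<le> ?B \<eta>"
      using \<mu> by (auto simp: is_minimum_def)
    have \<mu>_le_A: "\<mu> \<le> ?A \<theta>" for \<theta>
      using \<mu>_le[OF restr] BA order_trans by blast
    \<comment> \<open>The minimizer of (B) extends to a point of (A) at the same level, so the lower
      bound \<open>\<mu>_le_A\<close> is attained.\<close>
    obtain t where t: "?A (\<eta>(N := t)) \<le> \<mu>"
      using B_iff[of \<eta> \<mu>] \<eta> N by auto
    have minA: "is_minimum ?A (tuples N) \<mu>"
      using t \<mu>_le_A upd[OF \<eta>(1), of t]
      unfolding is_minimum_def by (metis antisym image_eqI)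
    \<comment> \<open>Optimality becomes membership in a sublevel set, so that \<open>A_iff\<close>
      at level \<open>\<mu>\<close> is the claimed equivalence.\<close>
    have minimizer_iff: "is_minimizer f S x \<longleftrightarrow> f x \<le> m"
      if "is_minimum f S m" "x \<in> S" for f :: "(nat \<Rightarrow> real) \<Rightarrow> real" and S x m
      using that unfolding is_minimum_def is_minimizer_def is_arg_min_linorder
      by force
    show ?thesis
      using minA minimizer_iff[OF minA] minimizer_iff[OF \<mu> restr]
      unfolding A_iff objective_B_restrict by blast
  qed
  ultimately show ?thesis by blast
qed

end
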